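(* For all positive integers $m$ and $n$, the rectangular Narayana polynomial $N(n,m;t)$ has only real zeros (as a polynomial in $t$).
   Context: For positive integers $m,n$, a lattice word of weight $(m^n)$ is a word $\mathtt{w}=w_1w_2\cdots w_{nm}$ in the symbols $1,2,\ldots,m$ such that (a) each $i$ with $1\le i\le m$ occurs exactly $n$ times, and (b) for each $1\le r\le nm$ and each $1\le i\le m-1$, the number of $i$'s in $w_1\cdots w_r$ is at least the number of $(i+1)$'s in $w_1\cdots w_r$. Let $\mathcal{N}(n,m)$ be the set of such words. A descent of a word $\mathtt{w}=w_1\cdots w_p$ is an index $i$ with $w_i>w_{i+1}$, and $\operatorname{des}(\mathtt{w})$ denotes the number of descents. The rectangular Narayana polynomial is $N(n,m;t)=\sum_{\mathtt{w}\in\mathcal{N}(n,m)} t^{\operatorname{des}(\mathtt{w})}$. *)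

theory Defs
  imports Complex_Main "HOL-Computational_Algebra.Polynomial"
begin

(* A word w_1 ... w_p is a nat list; the letter w_i is w ! (i - 1), and
   the prefix w_1 ... w_r is take r w. *)

definition lattice_words :: "nat \<Rightarrow> nat \<Rightarrow> nat list set" where
  "lattice_words n m =
     {w. length w = n * m \<and> set w \<subseteq> {1..m} \<and>
         (\<forall>i\<in>{1..m}. count_list w i = n) \<and>
         (\<forall>r\<in>{1..n * m}. \<forall>i\<in>{1..m - 1}.
            count_list (take r w) (i + 1) \<le> count_list (take r w) i)}"

definition des :: "nat list \<Rightarrow> nat" where
  "des w = card {i. 1 \<le> i \<and> i < length w \<and> w ! (i - 1) > w ! i}"

definition narayana_poly :: "nat \<Rightarrow> nat \<Rightarrow> real poly" where
  "narayana_poly n m = (\<Sum>w\<in>lattice_words n m. monom 1 (des w))"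

(* The sum defining narayana_poly is therefore not the default value 0 of
   a sum over an infinite set. *)
lemma finite_lattice_words: "finite (lattice_words n m)"
proof (rule finite_subset)
  show "lattice_words n m \<subseteq> {w. set w \<subseteq> {1..m} \<and> length w = n * m}"
    by (auto simp: lattice_words_def)
  show "finite {w. set w \<subseteq> {1..m} \<and> length w = n * m}"
    by (rule finite_lists_length_eq) simp
qed

end

theory Submission
  imports "Jordan_Normal_Form.Determinant" "HOL-Computational_Algebra.Polynomial_FPS" Defs
begin

text \<open>Let \<open>p = n m\<close>. A word with \<open>d\<close> descents contributes \<open>t ^ d\<close> to the Narayana polynomial and
  \<open>(k + p - d choose p)\<close> to the coefficient of \<open>t ^ k\<close> in its quotient by \<open>(1 - t) ^ (p + 1)\<close>. For lattice
  words of an arbitrary partition weight the sum of these coefficients is a determinant of binomial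
  coefficients: removing the last letter of a word corresponds to Pascal's rule in one row. For the
  rectangle the determinant is a constant times the product of all \<open>k + i + j\<close> with
  \<open>0 \<le> i < m\<close> and \<open>1 \<le> j \<le> n\<close>.

  The series with these coefficients arises from \<open>1 / (1 - t)\<close> by repeatedly applying
  \<open>F \<mapsto> t F' + a F\<close>, where each \<open>a\<close> exceeds the largest earlier one by at most 1. By counting
  sign changes, as in Rolle's theorem, every such step preserves that all zeros of the numerator are
  real, negative and simple.\<close>

subsection \<open>Lattice words of given weight\<close>

text \<open>Quantifying over all \<open>r\<close> and \<open>i\<close> keeps \<open>n\<close> and
  \<open>m\<close> out of the condition, so it applies to prefixes and to every weight.\<close>

definition ballot :: "nat list \<Rightarrow> bool" where
  "ballot w \<longleftrightarrow> (\<forall>r. \<forall>i\<ge>1. count_list (take r w) (i + 1) \<le> count_list (take r w) i)"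

definition words_of_weight :: "(nat \<Rightarrow> nat) \<Rightarrow> nat list set" where
  "words_of_weight L = {w. ballot w \<and> count_list w = L}"

lemma ballot_Nil [simp]: "ballot []"
  by (simp add: ballot_def)

lemma ballot_counts: "ballot w \<Longrightarrow> i \<ge> 1 \<Longrightarrow> count_list w (i + 1) \<le> count_list w i"
  unfolding ballot_def by (metis take_all order_refl)

lemma ballot_snoc:
  "ballot (u @ [x]) \<longleftrightarrow>
     ballot u \<and> (\<forall>i\<ge>1. count_list (u @ [x]) (i + 1) \<le> count_list (u @ [x]) i)"
proof
  assume b: "ballot (u @ [x])"
  have "count_list (take r u) (i + 1) \<le> count_list (take r u) i" if "i \<ge> 1" for r i
  proof -
    have "take r u = take (min r (length u)) (u @ [x])"
      by (simp add: min_def)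
    then show ?thesis using b that unfolding ballot_def by metis
  qed
  then show "ballot u \<and> (\<forall>i\<ge>1. count_list (u @ [x]) (i + 1) \<le> count_list (u @ [x]) i)"
    using ballot_counts[OF b] by (auto simp: ballot_def)
next
  assume b: "ballot u \<and> (\<forall>i\<ge>1. count_list (u @ [x]) (i + 1) \<le> count_list (u @ [x]) i)"
  show "ballot (u @ [x])"
    unfolding ballot_def
  proof (intro allI impI)
    fix r i :: nat assume "i \<ge> 1"
    show "count_list (take r (u @ [x])) (i + 1) \<le> count_list (take r (u @ [x])) i"
    proof (cases "r \<le> length u")
      case True
      then show ?thesis using b \<open>i \<ge> 1\<close> by (simp add: ballot_def)
    next
      case False
      then have "take r (u @ [x]) = u @ [x]" by simp
      then show ?thesis using b \<open>i \<ge> 1\<close> by metis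
    qed
  qed
qed

text \<open>Partitions with at most \<open>m\<close> parts, indexed from 1. The zero entry at
  \<open>m + 1\<close> lets \<open>L (x + 1) < L x\<close> also test the last row, and
  \<open>L 0 = 0\<close> excludes the letter 0, which \<open>ballot\<close> leaves
  unconstrained.\<close>

definition is_shape :: "nat \<Rightarrow> (nat \<Rightarrow> nat) \<Rightarrow> bool" where
  "is_shape m L \<longleftrightarrow> L 0 = 0 \<and> (\<forall>i>m. L i = 0) \<and> (\<forall>i\<ge>1. L (i + 1) \<le> L i)"

text \<open>The last letter marks a removable corner of the Young diagram. Strictness comes from the
  ballot condition on \<open>u\<close>, which contains one \<open>x\<close> fewer.\<close>

lemma words_of_weight_snoc:
  assumes "is_shape m L" "x \<ge> 1"
  shows "u @ [x] \<in> words_of_weight L \<longleftrightarrow>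
     L (x + 1) < L x \<and> u \<in> words_of_weight (L(x := L x - 1))"
proof
  assume "u @ [x] \<in> words_of_weight L"
  then have b: "ballot (u @ [x])" and L: "L = count_list (u @ [x])"
    by (auto simp: words_of_weight_def)
  have bu: "ballot u" using b by (simp add: ballot_snoc)
  have cu: "count_list u = L(x := L x - 1)" by (auto simp: L)
  have "count_list u (x + 1) \<le> count_list u x" using ballot_counts[OF bu] assms by simp
  moreover have "L (x + 1) = count_list u (x + 1)" "L x = Suc (count_list u x)"
    by (simp_all add: L)
  ultimately have "L (x + 1) < L x" by simp
  then show "L (x + 1) < L x \<and> u \<in> words_of_weight (L(x := L x - 1))"
    using bu cu by (simp add: words_of_weight_def)
next
  assume r: "L (x + 1) < L x \<and> u \<in> words_of_weight (L(x := L x - 1))"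
  then have bu: "ballot u" and cu: "count_list u = L(x := L x - 1)"
    by (auto simp: words_of_weight_def)
  have c: "count_list (u @ [x]) = L"
    by (rule ext) (use r in \<open>auto simp: cu\<close>)
  have "ballot (u @ [x])" unfolding ballot_snoc c
    using bu assms by (simp add: is_shape_def)
  then show "u @ [x] \<in> words_of_weight L" using c by (simp add: words_of_weight_def)
qed

lemma is_shape_lower:
  assumes "is_shape m L" "x \<ge> 1" "L (x + 1) < L x"
  shows "is_shape m (L(x := L x - 1))"
  using assms unfolding is_shape_def by (auto simp: le_diff_conv2)

lemma letters_words_of_weight:
  assumes "is_shape m L" "w \<in> words_of_weight L"
  shows "set w \<subseteq> {1..m}"
proof
  fix x assume "x \<in> set w"
  then have "L x \<noteq> 0"
    using assms(2) unfolding words_of_weight_def by (metis (mono_tags) count_list_0_iff mem_Collect_eq)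
  then have "x \<noteq> 0" "\<not> x > m" using assms(1) unfolding is_shape_def by metis+
  then show "x \<in> {1..m}" by simp
qed

lemma length_words_of_weight:
  assumes "is_shape m L" "w \<in> words_of_weight L"
  shows "length w = (\<Sum>i=1..m. L i)"
proof -
  have "length w = (\<Sum>i\<in>set w. count_list w i)" by (simp add: sum_count_set)
  also have "\<dots> = (\<Sum>i=1..m. count_list w i)"
    using letters_words_of_weight[OF assms]
    by (intro sum.mono_neutral_left) (auto simp: count_list_0_iff)
  finally show ?thesis using assms(2) by (simp add: words_of_weight_def)
qed

lemma finite_words_of_weight:
  assumes "is_shape m L"
  shows "finite (words_of_weight L)"
proof (rule finite_subset)
  show "words_of_weight L \<subseteq> {w. set w \<subseteq> {1..m} \<and> length w = (\<Sum>i=1..m. L i)}"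
    using letters_words_of_weight[OF assms] length_words_of_weight[OF assms] by blast
qed (auto intro: finite_lists_length_eq)

lemma lattice_words_eq:
  "lattice_words n m = words_of_weight (\<lambda>i. if i \<in> {1..m} then n else 0)"
  (is "_ = words_of_weight ?L")
proof (intro Set.equalityI subsetI)
  have shape: "is_shape m ?L" by (auto simp: is_shape_def)
  fix w assume w: "w \<in> words_of_weight ?L"
  then have c: "count_list w = ?L" and b: "ballot w" by (auto simp: words_of_weight_def)
  show "w \<in> lattice_words n m"
    using letters_words_of_weight[OF shape w] length_words_of_weight[OF shape w] b
    by (auto simp: lattice_words_def c ballot_def)
next
  fix w assume w: "w \<in> lattice_words n m"
  have c: "count_list w = ?L"
    using w by (fastforce simp: lattice_words_def count_list_0_iff)
  have "count_list (take r w) (i + 1) \<le> count_list (take r w) i" if "i \<ge> 1" for r i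
  proof (cases "i + 1 \<le> m \<and> r \<ge> 1")
    case True
    \<comment> \<open>Prefix lengths beyond the length of the word add no condition.\<close>
    have "take r w = take (min r (n * m)) w"
      using w by (auto simp: lattice_words_def min_def)
    moreover have "r > 0 \<Longrightarrow> w = [] \<or> min r (n * m) \<in> {1..n * m}"
      using w by (cases n; cases m) (auto simp: lattice_words_def)
    ultimately show ?thesis using w True that unfolding lattice_words_def
      by (cases "w = []") (auto simp del: take_take)
  next
    case False
    \<comment> \<open>Letters above \<open>m\<close> never occur, and for \<open>r = 0\<close> the
      prefix is empty.\<close>
    have "i + 1 \<notin> set w" if "i + 1 > m" using w that by (auto simp: lattice_words_def)
    then show ?thesis using False
      by (auto dest: in_set_takeD simp: count_list_0_iff not_le) (metis count_notin in_set_takeD le0)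
  qed
  then show "w \<in> words_of_weight ?L" using c by (simp add: words_of_weight_def ballot_def)
qed

section \<open>Descents and the recursion over the last letter\<close>

lemma des_Nil [simp]: "des [] = 0"
  by (simp add: des_def)

lemma des_snoc: "des (u @ [x]) = des u + of_bool (u \<noteq> [] \<and> last u > x)"
proof -
  let ?D = "\<lambda>w :: nat list. {i. 1 \<le> i \<and> i < length w \<and> w ! (i - 1) > w ! i}"
  have "?D (u @ [x]) = ?D u \<union> (if u \<noteq> [] \<and> last u > x then {length u} else {})"
    by (cases "u = []") (auto simp: nth_append last_conv_nth less_Suc_eq split: if_splits)
  then show ?thesis unfolding des_def by (auto simp: card_insert_if)
qed

lemma des_le: "des w \<le> length w - 1"
proof -
  have "des w \<le> card {1..<length w}" unfolding des_def by (intro card_mono) auto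
  then show ?thesis by simp
qed

text \<open>For a nonempty word of length \<open>p\<close> this counts the sequences \<open>a\<^sub>1 \<le> \<dots> \<le> a\<^sub>p\<close> in \<open>{0..k}\<close> that
  strictly increase at the descents of \<open>w\<close>, where \<open>a\<^sub>p = k\<close> is allowed only if the last letter is
  at most \<open>r\<close>. The truncated subtraction is harmless: if there is no such sequence, the upper
  index is smaller than \<open>p\<close>.\<close>

definition compatible_count :: "nat \<Rightarrow> nat \<Rightarrow> nat list \<Rightarrow> real" where
  "compatible_count k r w = real ((k + of_bool (w = [] \<or> last w \<le> r) + length w - 1 - des w) choose length w)"

text \<open>The threshold matters only for the last letter \<open>r + 1\<close>. The sequences
  gained then end in \<open>k\<close>; deleting this entry leaves one for \<open>u\<close>, which
  may again end in \<open>k\<close> only if no descent follows. Numerically this is Pascal's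
  rule.\<close>

lemma compatible_count_snoc_diff:
  "compatible_count k (Suc r) (u @ [x]) - compatible_count k r (u @ [x]) = (if x = Suc r then compatible_count k (Suc r) u else 0)"
proof (cases "x = Suc r")
  case False
  then show ?thesis by (simp add: compatible_count_def le_Suc_eq)
next
  case True
  define a where "a = k + length u - des (u @ [x])"
  have d: "des (u @ [x]) \<le> length u" using des_le[of "u @ [x]"] by simp
  have "compatible_count k (Suc r) (u @ [x]) = real (Suc a choose Suc (length u))"
    using d True by (simp add: compatible_count_def a_def Suc_diff_le)
  moreover have "compatible_count k r (u @ [x]) = real (a choose Suc (length u))"
    using True by (simp add: compatible_count_def a_def)
  \<comment> \<open>A final descent adds 1 to \<open>des (u @ [x])\<close> exactly when
    \<open>u\<close> loses the 1 granted by the threshold, so the upper index is \<open>a\<close> in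
    either case.\<close>
  moreover have "compatible_count k (Suc r) u = real (a choose length u)"
    using True by (auto simp: compatible_count_def a_def des_snoc)
  ultimately show ?thesis using True by simp
qed

text \<open>Only words ending in \<open>r + 1\<close> contribute to the difference; deleting that
  letter maps them bijectively onto the words of the lowered weight.\<close>

lemma sum_compatible_count_step:
  assumes L: "is_shape m L"
  shows "(\<Sum>w\<in>words_of_weight L. compatible_count k (Suc r) w) = (\<Sum>w\<in>words_of_weight L. compatible_count k r w) +
    (if L (Suc (Suc r)) < L (Suc r)
     then \<Sum>u\<in>words_of_weight (L(Suc r := L (Suc r) - 1)). compatible_count k (Suc r) u else 0)"
proof -
  let ?W = "words_of_weight L"
  let ?A = "{w \<in> ?W. w \<noteq> [] \<and> last w = Suc r}"
  let ?U = "{u. u @ [Suc r] \<in> ?W}"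
  have fin: "finite ?W" by (rule finite_words_of_weight[OF L])
  have diff: "compatible_count k (Suc r) w - compatible_count k r w =
      (if w \<noteq> [] \<and> last w = Suc r then compatible_count k (Suc r) (butlast w) else 0)" for w
  proof (cases w rule: rev_cases)
    case Nil
    then show ?thesis by (simp add: compatible_count_def)
  next
    case (snoc u x)
    show ?thesis unfolding snoc compatible_count_snoc_diff by simp
  qed
  have "(\<Sum>w\<in>?W. compatible_count k (Suc r) w) - (\<Sum>w\<in>?W. compatible_count k r w) =
      (\<Sum>w\<in>?A. compatible_count k (Suc r) (butlast w))"
    using fin by (simp add: diff sum.If_cases Int_def flip: sum_subtractf)
  also have "\<dots> = (\<Sum>u\<in>?U. compatible_count k (Suc r) u)"
    by (rule sum.reindex_bij_witness[of _ "\<lambda>u. u @ [Suc r]" butlast]) (auto, metis append_butlast_last_id, metis append_butlast_last_id)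
  also have "?U = (if L (Suc (Suc r)) < L (Suc r) then words_of_weight (L(Suc r := L (Suc r) - 1)) else {})"
    using words_of_weight_snoc[OF L, of "Suc r"] by auto
  finally show ?thesis by (simp split: if_splits)
qed

subsection \<open>Binomial determinants\<close>

lemma det_mat_row_add:
  fixes c :: "nat \<Rightarrow> nat \<Rightarrow> 'a :: comm_ring_1"
  assumes "k < n"
  shows "det (mat n n (\<lambda>(i, j). if i = k then a j + b j else c i j)) =
    det (mat n n (\<lambda>(i, j). if i = k then a j else c i j)) +
    det (mat n n (\<lambda>(i, j). if i = k then b j else c i j))"
proof -
  have rows: "mat n n (\<lambda>(i, j). if i = k then g j else c i j) =
      mat\<^sub>r n n (\<lambda>i. if i = k then vec n g else vec n (c i))" for g
    by (rule eq_matI) (auto simp: mat_of_rows_def)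
  have sum: "vec n (\<lambda>j. a j + b j) = vec n a + vec n b"
    by (rule eq_vecI) auto
  show ?thesis
    unfolding rows sum
    by (rule det_row_add[where a = "\<lambda>_. vec n a" and b = "\<lambda>_. vec n b" and c = "\<lambda>i. vec n (c i)"])
       (use assms in auto)
qed

text \<open>Splitting the row as \<open>0 + 0\<close> shows that the determinant is twice
  itself.\<close>

lemma det_mat_row_zero:
  fixes c :: "nat \<Rightarrow> nat \<Rightarrow> 'a :: comm_ring_1"
  assumes "k < n"
  shows "det (mat n n (\<lambda>(i, j). if i = k then 0 else c i j)) = 0"
  using det_mat_row_add[OF assms, of "\<lambda>_. 0" "\<lambda>_. 0" c]
  by (simp only: add_0_right add_cancel_right_right)

text \<open>In the Leibniz expansion every permutation uses each row factor and each column factor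
  once.\<close>

lemma det_mat_scale:
  fixes c :: "nat \<Rightarrow> nat \<Rightarrow> 'a :: comm_ring_1"
  shows "det (mat n n (\<lambda>(i, j). a i * b j * c i j)) =
    (\<Prod>i<n. a i) * (\<Prod>j<n. b j) * det (mat n n (\<lambda>(i, j). c i j))"
proof -
  have "(\<Prod>i = 0..<n. mat n n (\<lambda>(i, j). a i * b j * c i j) $$ (i, p i)) =
      (\<Prod>i<n. a i) * (\<Prod>j<n. b j) * (\<Prod>i = 0..<n. mat n n (\<lambda>(i, j). c i j) $$ (i, p i))"
    if p: "p permutes {0..<n}" for p
  proof -
    have "p i < n" if "i < n" for i using permutes_in_image[OF p] that by auto
    then have "(\<Prod>i = 0..<n. mat n n (\<lambda>(i, j). a i * b j * c i j) $$ (i, p i)) =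
        (\<Prod>i = 0..<n. a i * b (p i) * mat n n (\<lambda>(i, j). c i j) $$ (i, p i))"
      by (intro prod.cong) auto
    also have "\<dots> = (\<Prod>i = 0..<n. a i) * (\<Prod>i = 0..<n. b (p i)) *
        (\<Prod>i = 0..<n. mat n n (\<lambda>(i, j). c i j) $$ (i, p i))"
      by (simp add: prod.distrib)
    also have "(\<Prod>i = 0..<n. b (p i)) = (\<Prod>i = 0..<n. b i)"
      using prod.permute[OF p, of b] by (simp add: o_def)
    finally show ?thesis by (simp add: atLeast0LessThan)
  qed
  then show ?thesis
    by (simp add: det_def'[of _ n] sum_distrib_left mult_ac)
qed

text \<open>By Vandermonde's convolution the matrix is a product of two unitriangular ones.\<close>

lemma det_binomial_shift:
  "det (mat n n (\<lambda>(i, j). real ((k + i) choose j))) = 1"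
proof -
  define A where "A = mat n n (\<lambda>(i, j). real (i choose j))"
  define B where "B = mat n n (\<lambda>(i, j). if i \<le> j then real (k choose (j - i)) else 0)"
  have AB: "A \<in> carrier_mat n n" "B \<in> carrier_mat n n" by (auto simp: A_def B_def)
  have "mat n n (\<lambda>(i, j). real ((k + i) choose j)) = A * B"
  proof (rule eq_matI)
    fix i j assume "i < dim_row (A * B)" "j < dim_col (A * B)"
    then have i: "i < n" and j: "j < n" using AB by auto
    have "real ((k + i) choose j) = (\<Sum>a\<le>j. real (i choose a) * real (k choose (j - a)))"
      by (simp only: vandermonde add.commute[of k i] flip: of_nat_mult of_nat_sum)
    also have "\<dots> = (\<Sum>a = 0..<n. real (i choose a) * (if a \<le> j then real (k choose (j - a)) else 0))"
      using j by (intro sum.mono_neutral_cong_left) auto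
    also have "\<dots> = (A * B) $$ (i, j)"
      using i j AB by (simp add: scalar_prod_def A_def B_def)
    finally show "mat n n (\<lambda>(i, j). real ((k + i) choose j)) $$ (i, j) = (A * B) $$ (i, j)"
      using i j by simp
  qed (use AB in auto)
  moreover have "diag_mat A = replicate n 1" "diag_mat B = replicate n 1"
    by (auto simp: diag_mat_def A_def B_def intro!: nth_equalityI)
  moreover have "det A = prod_list (diag_mat A)"
    using AB by (intro det_lower_triangular[of n]) (auto simp: A_def)
  moreover have "det B = prod_list (diag_mat B)"
    using AB by (intro det_upper_triangular[of _ n]) (auto simp: B_def)
  ultimately show ?thesis by (simp add: det_mult[OF AB])
qed

text \<open>Row \<open>i\<close> belongs to the letter \<open>i + 1\<close>. The upper index can be \<open>-1\<close>, which is why generalized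
  binomial coefficients are used.\<close>

definition weight_det :: "nat \<Rightarrow> (nat \<Rightarrow> nat) \<Rightarrow> nat \<Rightarrow> nat \<Rightarrow> real" where
  "weight_det m L k r = det (mat m m (\<lambda>(i, j).
     (real (L (Suc i) + k + of_bool (i < r) + (m - 1)) - 1 - real j) gchoose
     (L (Suc i) + (m - 1 - i))))"

text \<open>At \<open>r = m\<close> every row carries the shift by 1, which amounts to raising
  \<open>k\<close>.\<close>

lemma weight_det_wrap: "weight_det m L (Suc k) 0 = weight_det m L k m"
  unfolding weight_det_def
  by (rule arg_cong[of _ _ det], rule eq_matI) (auto simp: algebra_simps)

text \<open>Pascal's rule in row \<open>r\<close> lowers \<open>L (r + 1)\<close> by one; if the result is not a shape, the lowered row
  vanishes or coincides with the next one.\<close>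

lemma weight_det_step:
  assumes L: "is_shape m L" and r: "r < m"
  shows "weight_det m L k (Suc r) = weight_det m L k r +
    (if L (Suc (Suc r)) < L (Suc r)
     then weight_det m (L(Suc r := L (Suc r) - 1)) k (Suc r) else 0)"
proof -
  define q where "q i = real (L (Suc i) + k + of_bool (i < r) + (m - 1)) - 1" for i
  define l where "l i = L (Suc i) + (m - 1 - i)" for i
  define c where "c i j = (q i - real j) gchoose (l i)" for i j
  \<comment> \<open>With lower index 0 both binomial coefficients are 1, so there is no correction
    term.\<close>
  define b where "b j = (if l r = 0 then 0 else (q r - real j) gchoose (l r - 1))" for j
  have pascal: "(q r + 1 - real j) gchoose l r = c r j + b j" for j
  proof (cases "l r")
    case 0
    then show ?thesis by (simp add: c_def b_def)
  next
    case (Suc l')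
    have "q r + 1 - real j = (q r - real j) + 1" by simp
    then show ?thesis using Suc by (simp only: c_def b_def gbinomial_Suc_Suc) simp
  qed
  have "weight_det m L k (Suc r) = det (mat m m (\<lambda>(i, j). if i = r then c r j + b j else c i j))"
    unfolding weight_det_def
  proof (rule arg_cong[of _ _ det], rule eq_matI, goal_cases)
    case (1 i j)
    show ?case
    proof (cases "i = r")
      case True
      then show ?thesis using 1 pascal[of j] by (simp add: q_def l_def algebra_simps)
    next
      case False
      then show ?thesis using 1 by (simp add: q_def l_def c_def less_Suc_eq)
    qed
  qed auto
  also have "\<dots> = det (mat m m (\<lambda>(i, j). if i = r then c r j else c i j)) +
      det (mat m m (\<lambda>(i, j). if i = r then b j else c i j))"
    by (rule det_mat_row_add[OF r])
  also have "mat m m (\<lambda>(i, j). if i = r then c r j else c i j) = mat m m (\<lambda>(i, j). c i j)"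
    by (rule eq_matI) auto
  also have "det \<dots> = weight_det m L k r"
    by (simp add: weight_det_def c_def q_def l_def)
  also have "det (mat m m (\<lambda>(i, j). if i = r then b j else c i j)) =
    (if L (Suc (Suc r)) < L (Suc r)
     then weight_det m (L(Suc r := L (Suc r) - 1)) k (Suc r) else 0)"
  proof (cases "L (Suc (Suc r)) < L (Suc r)")
    case True
    then obtain t where t: "L (Suc r) = Suc t" by (cases "L (Suc r)") auto
    have "det (mat m m (\<lambda>(i, j). if i = r then b j else c i j)) =
        weight_det m (L(Suc r := L (Suc r) - 1)) k (Suc r)"
      unfolding weight_det_def
      by (rule arg_cong[of _ _ det], rule eq_matI)
         (auto simp: b_def c_def q_def l_def t less_Suc_eq algebra_simps)
    then show ?thesis using True by simp
  next
    case False
    have "L (Suc (Suc r)) \<le> L (Suc r)" using L by (auto simp: is_shape_def)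
    then have same: "L (Suc (Suc r)) = L (Suc r)" using False by simp
    have "det (mat m m (\<lambda>(i, j). if i = r then b j else c i j)) = 0"
    proof (cases "Suc r = m")
      case True
      then have b0: "b = (\<lambda>_. 0)" using L same by (simp add: fun_eq_iff b_def l_def is_shape_def)
      show ?thesis unfolding b0 by (rule det_mat_row_zero[OF r])
    next
      case False
      then have r': "Suc r < m" using r by simp
      \<comment> \<open>Row \<open>r + 1\<close> is not shifted yet. For equal parts its lower index
        is one less than that of row \<open>r\<close>, because of the summand
        \<open>m - 1 - i\<close>.\<close>
      have "l r = Suc (l (Suc r))" "q (Suc r) = q r" using r' same by (auto simp: l_def q_def)
      then have "b j = c (Suc r) j" for j by (simp add: b_def c_def)
      then show ?thesis using r r'
        by (intro det_identical_rows[of _ m r "Suc r"]) (auto intro!: eq_vecI)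
    qed
    then show ?thesis using False by simp
  qed
  finally show ?thesis .
qed

text \<open>For the empty shape the Pascal step adds nothing, so the value depends on neither
  \<open>k\<close> nor \<open>r\<close>.\<close>

lemma weight_det_empty:
  assumes "r \<le> m"
  shows "weight_det m (\<lambda>_. 0) k r = 1"
proof -
  have shape: "is_shape m (\<lambda>_. 0)" by (simp add: is_shape_def)
  have row: "weight_det m (\<lambda>_. 0) k r = weight_det m (\<lambda>_. 0) k 0" if "r \<le> m" for r k
    using that by (induction r) (simp_all add: weight_det_step[OF shape])
  have "weight_det m (\<lambda>_. 0) k 0 = weight_det m (\<lambda>_. 0) 0 0" for k
    by (induction k) (simp_all add: weight_det_wrap row[of m])
  \<comment> \<open>At \<open>k = 1\<close> and \<open>r = 0\<close> the upper index is the natural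
    number \<open>m - 1 - j\<close>, which makes the matrix unitriangular.\<close>
  then have "weight_det m (\<lambda>_. 0) k r = weight_det m (\<lambda>_. 0) (Suc 0) 0"
    using row[OF assms, of k] by metis
  also have "weight_det m (\<lambda>_. 0) (Suc 0) 0 = det (mat m m (\<lambda>(i, j). real ((m - 1 - j) choose (m - 1 - i))))"
    unfolding weight_det_def
    by (rule arg_cong[of _ _ det], rule eq_matI) (auto simp: binomial_gbinomial algebra_simps)
  also have "\<dots> = prod_list (diag_mat (mat m m (\<lambda>(i, j). real ((m - 1 - j) choose (m - 1 - i)))))"
    by (rule det_lower_triangular[of m]) auto
  also have "diag_mat (mat m m (\<lambda>(i, j). real ((m - 1 - j) choose (m - 1 - i)))) = replicate m 1"
    by (auto simp: diag_mat_def intro!: nth_equalityI)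
  finally show ?thesis by simp
qed

text \<open>The first row vanishes: its upper index \<open>L 1 + m - 2 - j\<close> is smaller than
  the lower one and, since \<open>L 1 > 0\<close>, not negative.\<close>

lemma weight_det_start:
  assumes "m > 0" "L 1 > 0"
  shows "weight_det m L 0 0 = 0"
proof -
  have zero: "(real (L (Suc 0) + 0 + of_bool (0 < (0::nat)) + (m - 1)) - 1 - real j) gchoose
      (L (Suc 0) + (m - 1 - 0)) = 0" if "j < m" for j
  proof -
    have "real (L (Suc 0) + 0 + of_bool (0 < (0::nat)) + (m - 1)) - 1 - real j
        = real (L 1 + (m - 1) - 1 - j)"
      using assms that by (simp add: of_nat_diff)
    moreover have "real (L 1 + (m - 1) - 1 - j) gchoose (L 1 + (m - 1)) = 0"
      using assms by (subst binomial_gbinomial[symmetric]) (simp add: binomial_eq_0)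
    ultimately show ?thesis by (simp only: One_nat_def diff_zero)
  qed
  have "weight_det m L 0 0 = det (mat m m (\<lambda>(i, j). if i = 0 then 0 else
     (real (L (Suc i) + 0 + of_bool (i < 0) + (m - 1)) - 1 - real j) gchoose
     (L (Suc i) + (m - 1 - i))))"
    unfolding weight_det_def
  proof (rule arg_cong[of _ _ det], rule eq_matI, goal_cases)
    case (1 i j)
    then show ?case using zero[of j] by (cases "i = 0") simp_all
  qed auto
  then show ?thesis using det_mat_row_zero[OF assms(1)] by simp
qed

text \<open>Both sides obey the same recursion in \<open>r\<close> and the same passage from
  \<open>(k, m)\<close> to \<open>(k + 1, 0)\<close>, and for nonempty shapes both vanish at
  \<open>(0, 0)\<close>. The outer induction is on the size of the shape.\<close>

lemma sum_compatible_count_eq_weight_det: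
  assumes "is_shape m L" "r \<le> m"
  shows "(\<Sum>w\<in>words_of_weight L. compatible_count k r w) = weight_det m L k r"
  using assms
proof (induction "\<Sum>i=1..m. L i" arbitrary: L k r rule: less_induct)
  case less
  note L = less.prems(1)
  show ?case
  proof (cases "L = (\<lambda>_. 0)")
    case True
    have "words_of_weight L = {[]}"
      using length_words_of_weight[OF L] True
      by (auto simp: words_of_weight_def)
    then show ?thesis using weight_det_empty[OF less.prems(2)] True by (simp add: compatible_count_def)
  next
    case False
    have L1: "L i \<le> L 1" if "i \<ge> 1" for i
      using that
    proof (induction i rule: dec_induct)
      case (step i)
      then have "L (Suc i) \<le> L i" using L by (auto simp: is_shape_def)
      then show ?case using step by simp
    qed simp
    obtain i where "L i > 0" using False by (auto simp: fun_eq_iff)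
    moreover have "i \<ge> 1" using \<open>L i > 0\<close> L by (cases i) (auto simp: is_shape_def)
    ultimately have pos: "L 1 > 0" using L1[of i] by simp
    have m: "m > 0" using pos L by (auto simp: is_shape_def intro: ccontr)
    have ne: "w \<noteq> []" and last: "1 \<le> last w" "last w \<le> m" if "w \<in> words_of_weight L" for w
    proof -
      show "w \<noteq> []" using that pos by (auto simp: words_of_weight_def)
      then have "last w \<in> {1..m}"
        using letters_words_of_weight[OF L that] last_in_set by blast
      then show "1 \<le> last w" "last w \<le> m" by auto
    qed
    have row: "(\<Sum>w\<in>words_of_weight L. compatible_count k r w) = weight_det m L k r"
      if base: "(\<Sum>w\<in>words_of_weight L. compatible_count k 0 w) = weight_det m L k 0" and "r \<le> m" for k r
      using \<open>r \<le> m\<close>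
    proof (induction r)
      case 0
      then show ?case using base by simp
    next
      case (Suc r)
      have "(\<Sum>u\<in>words_of_weight (L(Suc r := L (Suc r) - 1)). compatible_count k (Suc r) u) =
          weight_det m (L(Suc r := L (Suc r) - 1)) k (Suc r)"
        if lt: "L (Suc (Suc r)) < L (Suc r)"
      proof (rule less.hyps)
        show "(\<Sum>i=1..m. (L(Suc r := L (Suc r) - 1)) i) < (\<Sum>i=1..m. L i)"
          using lt Suc.prems by (intro sum_strict_mono_ex1) (auto intro!: bexI[of _ "Suc r"])
        show "is_shape m (L(Suc r := L (Suc r) - 1))"
          using is_shape_lower[OF L, of "Suc r"] lt by simp
      qed (rule Suc.prems)
      then show ?case
        using Suc by (simp add: sum_compatible_count_step[OF L] weight_det_step[OF L])
    qed
    have "(\<Sum>w\<in>words_of_weight L. compatible_count k 0 w) = weight_det m L k 0" for k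
    proof (induction k)
      case 0
      have "compatible_count 0 0 w = 0" if "w \<in> words_of_weight L" for w
        using ne[OF that] last[OF that] by (cases w) (auto simp: compatible_count_def)
      then show ?case using weight_det_start[of m L] m pos by simp
    next
      case (Suc k)
      \<comment> \<open>All last letters lie in \<open>{1..m}\<close>: threshold \<open>m\<close>
        admits the final value \<open>k\<close> for every word, threshold 0 admits
        \<open>k + 1\<close> for none.\<close>
      have "compatible_count (Suc k) 0 w = compatible_count k m w" if "w \<in> words_of_weight L" for w
        using ne[OF that] last[OF that] by (simp add: compatible_count_def)
      then show ?case using row[OF Suc, of m] by (simp add: weight_det_wrap)
    qed
    then show ?thesis using row less.prems(2) by blast
  qed
qed

section \<open>Product formula for rectangular weights\<close>

lemma fact_add_eq_prod: "fact (a + n) = (fact a :: real) * (\<Prod>j=1..n. real (a + j))"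
  by (induction n) (simp_all add: algebra_simps)

text \<open>Written with factorials, each entry is a row factor times a column factor times
  \<open>(k + i) choose j\<close>, and the matrix of the latter has determinant 1.\<close>

lemma weight_det_rectangle:
  "weight_det m (\<lambda>i. if i \<in> {1..m} then n else 0) (Suc k) 0 =
     (\<Prod>i<m. fact i / fact (n + i)) * (\<Prod>i<m. \<Prod>j=1..n. real (k + i + j))"
proof -
  define a :: "nat \<Rightarrow> real" where "a i = 1 / (fact (n + (m - 1 - i)) * fact (k + i))" for i
  define b :: "nat \<Rightarrow> real" where "b j = fact (n + k + (m - 1 - j)) * fact j" for j
  have entry: "(real (n + k + (m - 1)) - real j) gchoose (n + (m - 1 - i)) =
      a i * b j * real ((k + i) choose j)" if ij: "i < m" "j < m" for i j
  proof -
    have "(real (n + k + (m - 1)) - real j) gchoose (n + (m - 1 - i)) =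
        real ((n + k + (m - 1 - j)) choose (n + (m - 1 - i)))"
      using ij by (simp add: binomial_gbinomial algebra_simps)
    also have "\<dots> = a i * b j * real ((k + i) choose j)"
    proof (cases "j \<le> k + i")
      case True
      then have "n + k + (m - 1 - j) - (n + (m - 1 - i)) = k + i - j" "n + (m - 1 - i) \<le> n + k + (m - 1 - j)"
        using ij by auto
      then show ?thesis using True
        by (simp add: binomial_fact a_def b_def field_simps)
    next
      \<comment> \<open>Here the factorial formula fails, but both binomial coefficients are
        0.\<close>
      case False
      then have "(n + k + (m - 1 - j)) choose (n + (m - 1 - i)) = 0" "(k + i) choose j = 0"
        using ij by (auto intro!: binomial_eq_0)
      then show ?thesis by (simp only: of_nat_0 mult_zero_right)
    qed
    finally show ?thesis .
  qed
  have "weight_det m (\<lambda>i. if i \<in> {1..m} then n else 0) (Suc k) 0 =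
      det (mat m m (\<lambda>(i, j). a i * b j * real ((k + i) choose j)))"
    unfolding weight_det_def
  proof (rule arg_cong[of _ _ det], rule eq_matI, goal_cases)
    case (1 i j)
    then show ?case using entry[of i j] by (simp add: algebra_simps)
  qed auto
  also have "\<dots> = (\<Prod>i<m. a i) * (\<Prod>j<m. b j)"
    unfolding det_mat_scale[of m a b "\<lambda>i j. real ((k + i) choose j)"] det_binomial_shift by simp
  also have "(\<Prod>i<m. a i) = 1 / ((\<Prod>i<m. fact (n + i)) * (\<Prod>i<m. fact (k + i)))"
    unfolding a_def prod_dividef prod.distrib
    by (subst prod.nat_diff_reindex[of "\<lambda>i. fact (n + i)" m, symmetric]) simp
  also have "(\<Prod>j<m. b j) = (\<Prod>i<m. fact (n + k + i)) * (\<Prod>i<m. fact i)"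
    unfolding b_def prod.distrib
    by (subst prod.nat_diff_reindex[of "\<lambda>i. fact (n + k + i)" m, symmetric]) simp
  also have "(\<Prod>i<m. fact (n + k + i) :: real) = (\<Prod>i<m. fact (k + i)) * (\<Prod>i<m. \<Prod>j=1..n. real (k + i + j))"
    unfolding prod.distrib[symmetric]
  proof (rule prod.cong)
    fix i
    have "n + k + i = (k + i) + n" by simp
    then show "fact (n + k + i) = fact (k + i) * (\<Prod>j=1..n. real (k + i + j))"
      by (simp only: fact_add_eq_prod)
  qed simp
  finally show ?thesis by (simp add: prod_dividef)
qed

lemma sum_binomial_lattice_words:
  assumes "m > 0" "n > 0"
  shows "(\<Sum>w\<in>lattice_words n m. real ((k + n * m - des w) choose (n * m))) =
     (\<Prod>i<m. fact i / fact (n + i)) * (\<Prod>i<m. \<Prod>j=1..n. real (k + i + j))"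
proof -
  define L where "L = (\<lambda>i. if i \<in> {1..m} then n else 0)"
  have L: "is_shape m L" by (auto simp: is_shape_def L_def)
  \<comment> \<open>Threshold 0 excludes every last letter, so the 1 in \<open>Suc k\<close> just
    cancels the \<open>- 1\<close> in the upper index.\<close>
  have "compatible_count (Suc k) 0 w = real ((k + n * m - des w) choose (n * m))" if "w \<in> words_of_weight L" for w
  proof -
    have len: "length w = n * m" using length_words_of_weight[OF L that] by (simp add: L_def)
    then have "w \<noteq> []" using assms by auto
    then have "last w \<in> {1..m}"
      using letters_words_of_weight[OF L that] last_in_set by blast
    then have "last w \<noteq> 0" by simp
    then show ?thesis using len \<open>w \<noteq> []\<close> by (simp add: compatible_count_def)
  qed
  then have "(\<Sum>w\<in>lattice_words n m. real ((k + n * m - des w) choose (n * m))) =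
      (\<Sum>w\<in>words_of_weight L. compatible_count (Suc k) 0 w)"
    unfolding lattice_words_eq L_def by simp
  then show ?thesis
    using sum_compatible_count_eq_weight_det[OF L, of 0 "Suc k"] weight_det_rectangle[of m n k]
    by (simp add: L_def)
qed

subsection \<open>Numerators with simple negative zeros\<close>

text \<open>The strictly decreasing order encodes simplicity and ties the sign of the derivative at
  a zero to the parity of its index.\<close>

definition simple_neg_rooted :: "nat \<Rightarrow> real poly \<Rightarrow> bool" where
  "simple_neg_rooted e W \<longleftrightarrow>
     (\<exists>c x. c > 0 \<and> (\<forall>i<e. x i < 0) \<and> (\<forall>i j. i < j \<longrightarrow> j < e \<longrightarrow> x j < x i) \<and>
            W = smult c (\<Prod>i<e. [:- x i, 1:]))"

lemma degree_prod_linear: "degree (\<Prod>i<e. [:- x i, 1 :: real:]) = e"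
  by (subst degree_prod_eq_sum_degree) auto

text \<open>The intermediate value theorem puts a zero into each of \<open>E\<close> disjoint
  intervals left of 0, and the degree leaves room for no others.\<close>

lemma simple_neg_rootedI_sign_changes:
  fixes V :: "real poly"
  assumes deg: "degree V \<le> E"
    and z0: "z 0 = 0"
    and z_dec: "\<And>i. i < E \<Longrightarrow> z (Suc i) < z i"
    and sgn: "\<And>i. i \<le> E \<Longrightarrow> (-1) ^ i * poly V (z i) > 0"
  shows "simple_neg_rooted E V"
proof -
  have "\<exists>y>z (Suc i). y < z i \<and> poly V y = 0" if "i < E" for i
  proof (rule poly_IVT)
    show "z (Suc i) < z i" using that by (rule z_dec)
    have "0 < ((-1) ^ i * poly V (z i)) * ((-1) ^ Suc i * poly V (z (Suc i)))"
      using sgn[of i] sgn[of "Suc i"] that by (simp only: mult_pos_pos less_imp_le Suc_leI)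
    also have "\<dots> = - (((-1) ^ i * (-1) ^ i) * (poly V (z (Suc i)) * poly V (z i)))"
      by (simp add: algebra_simps)
    also have "(-1) ^ i * (-1) ^ i = (1 :: real)"
      by (simp flip: power_mult_distrib)
    finally show "poly V (z (Suc i)) * poly V (z i) < 0" by simp
  qed
  then obtain y where y: "\<And>i. i < E \<Longrightarrow> z (Suc i) < y i \<and> y i < z i \<and> poly V (y i) = 0"
    by metis
  have z_mono: "z j \<le> z i" if "i \<le> j" "j \<le> E" for i j
    using that
  proof (induction j rule: dec_induct)
    case (step k)
    then show ?case using z_dec[of k] by auto
  qed simp
  have y_dec: "y j < y i" if "i < j" "j < E" for i j
    using z_mono[of "Suc i" j] y[of i] y[of j] that by fastforce
  have y_neg: "y i < 0" if "i < E" for i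
    using z_mono[of 0 i] y[OF that] that z0 by fastforce
  define P where "P = (\<Prod>i<E. [:- y i, 1:])"
  have P0: "poly P 0 > 0"
    unfolding P_def poly_prod using y_neg by (auto intro!: prod_pos)
  have V0: "poly V 0 > 0" using sgn[of 0] z0 by simp
  \<comment> \<open>Matching the values at 0 gives, with the zeros, \<open>E + 1\<close> points of
    agreement, more than either degree.\<close>
  define c where "c = poly V 0 / poly P 0"
  have "c > 0" using P0 V0 by (simp add: c_def)
  have inj: "inj_on y {..<E}"
    by (rule inj_onI) (metis lessThan_iff linorder_neqE_nat order_less_irrefl y_dec)
  have "V = smult c P"
  proof (rule poly_eqI_degree)
    show "poly V t = poly (smult c P) t" if t: "t \<in> insert 0 (y ` {..<E})" for t
    proof (cases "t = 0")
      case True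
      then show ?thesis using P0 by (simp add: c_def)
    next
      case False
      then obtain i where "i < E" "t = y i" using t by auto
      then show ?thesis using y by (auto simp: P_def poly_prod)
    qed
    have "0 \<notin> y ` {..<E}" using y_neg by force
    then have "card (insert 0 (y ` {..<E})) = Suc E"
      using inj by (subst card_insert_disjoint) (auto simp: card_image)
    then show "card (insert 0 (y ` {..<E})) > degree V"
      and "card (insert 0 (y ` {..<E})) > degree (smult c P)"
      using deg degree_prod_linear[of y E] \<open>c > 0\<close> by (auto simp: P_def)
  qed
  then show ?thesis
    unfolding simple_neg_rooted_def P_def using \<open>c > 0\<close> y_neg y_dec by blast
qed

text \<open>Reflection at the origin, with the sign \<open>(-1) ^ degree V\<close>, keeps the
  leading coefficient and reduces the claim to plus infinity.\<close>

lemma poly_sign_at_bot: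
  fixes V :: "real poly"
  assumes "lead_coeff V > 0"
  shows "\<exists>t<b. (-1) ^ degree V * poly V t > 0"
proof -
  define Q where "Q = smult ((-1) ^ degree V) (pcompose V [:0, -1:])"
  have "lead_coeff Q = lead_coeff V"
    by (simp add: Q_def lead_coeff_comp flip: power_mult_distrib)
  with assms obtain N where N: "\<And>x. x \<ge> N \<Longrightarrow> poly Q x \<ge> lead_coeff V"
    using poly_pinfty_gt_lc[of Q] by auto
  define t where "t = - max N (1 - b)"
  have "poly Q (- t) > 0"
    using N[of "- t"] assms by (auto simp: t_def)
  then have "(-1) ^ degree V * poly V t > 0"
    by (simp add: Q_def poly_pcompose)
  moreover have "t < b" by (auto simp: t_def)
  ultimately show ?thesis by blast
qed

text \<open>Multiplying the \<open>k\<close>-th coefficient of \<open>F = W / (1 - X) ^ (d + 1)\<close> by \<open>k + a\<close> turns \<open>F\<close> into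
  \<open>X F' + a F\<close>; the step computes the numerator of the latter over \<open>(1 - X) ^ (d + 2)\<close>.\<close>

definition numerator_step :: "nat \<Rightarrow> nat \<Rightarrow> real poly \<Rightarrow> real poly" where
  "numerator_step d a W =
     [:1, -1:] * ([:0, 1:] * pderiv W + smult (real a) W) + smult (real d + 1) ([:0, 1:] * W)"

lemma coeff_linear_mult: "coeff ([:a, b:] * p) (Suc k) = a * coeff p (Suc k) + b * coeff p k"
  by simp

text \<open>At a zero \<open>x\<close> of \<open>W\<close> the new numerator is
  \<open>(1 - x) x W'(x)\<close>, which alternates in sign, and at 0 it is
  \<open>a W(0) > 0\<close>. This yields \<open>d - s\<close> zeros. The next coefficient is a
  positive multiple of \<open>s + 1 - a\<close>: it vanishes for \<open>a = s + 1\<close>, and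
  otherwise forces one more sign change far to the left.\<close>

lemma simple_neg_rooted_numerator_step:
  assumes W: "simple_neg_rooted (d - s) W" and "s \<le> d" "1 \<le> a" "a \<le> s + 1"
  shows "simple_neg_rooted (Suc d - max s a) (numerator_step d a W)"
proof -
  define e where "e = d - s"
  obtain c x where c: "c > 0" and x_neg: "\<And>i. i < e \<Longrightarrow> x i < 0"
    and x_dec: "\<And>i j. i < j \<Longrightarrow> j < e \<Longrightarrow> x j < x i"
    and W_eq: "W = smult c (\<Prod>i<e. [:- x i, 1:])"
    using W unfolding simple_neg_rooted_def e_def by blast
  define V where "V = numerator_step d a W"
  define z where "z i = (case i of 0 \<Rightarrow> 0 | Suc k \<Rightarrow> x k)" for i
  have degW: "degree W = e" and lcW: "coeff W e = c"
    using c degree_prod_linear[of x e] lead_coeff_prod[of "\<lambda>i. [:- x i, 1:]" "{..<e}"]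
    by (auto simp: W_eq)
  have sgn: "(-1) ^ i * poly V (z i) > 0" if "i \<le> e" for i
  proof (cases i)
    case 0
    have "poly W 0 > 0"
      using c x_neg by (auto simp: W_eq poly_prod intro!: mult_pos_pos prod_pos)
    then show ?thesis using 0 \<open>1 \<le> a\<close> by (simp add: V_def numerator_step_def z_def)
  next
    case (Suc k)
    then have k: "k < e" using that by simp
    \<comment> \<open>Removing the factor of \<open>x k\<close> gives
      \<open>W'(x k) = R(x k)\<close>, whose sign counts the \<open>k\<close> larger zeros.\<close>
    define R where "R = smult c (\<Prod>i\<in>{..<e} - {k}. [:- x i, 1:])"
    have WR: "W = [:- x k, 1:] * R"
      using k by (simp add: W_eq R_def prod.remove[of "{..<e}" k])
    have W0: "poly W (x k) = 0" by (simp add: WR)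
    have W1: "poly (pderiv W) (x k) = poly R (x k)"
      by (simp only: WR pderiv_mult poly_add poly_mult) (simp add: pderiv_pCons)
    have split: "{..<e} - {k} = {..<k} \<union> {k<..<e}" using k by auto
    have "(\<Prod>i\<in>{..<e} - {k}. x k - x i) =
        (\<Prod>i<k. x k - x i) * (\<Prod>i\<in>{k<..<e}. x k - x i)"
      unfolding split by (intro prod.union_disjoint) auto
    then have "poly R (x k) = c * ((\<Prod>i<k. x k - x i) * (\<Prod>i\<in>{k<..<e}. x k - x i))"
      by (simp add: R_def poly_prod)
    also have "(\<Prod>i<k. x k - x i) = (\<Prod>i<k. (-1) * (x i - x k))"
      by (intro prod.cong) auto
    also have "\<dots> = (-1) ^ k * (\<Prod>i<k. x i - x k)"
      by (subst prod.distrib) simp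
    finally have "(-1) ^ k * poly R (x k) =
        ((-1) ^ k * (-1) ^ k) * (c * ((\<Prod>i<k. x i - x k) * (\<Prod>i\<in>{k<..<e}. x k - x i)))"
      by (simp only: mult_ac)
    also have "(-1) ^ k * (-1) ^ k = (1 :: real)"
      by (simp flip: power_mult_distrib)
    finally have R: "(-1) ^ k * poly R (x k) =
        c * ((\<Prod>i<k. x i - x k) * (\<Prod>i\<in>{k<..<e}. x k - x i))"
      by simp
    have R_pos: "(-1) ^ k * poly R (x k) > 0"
      unfolding R using c k x_dec
      by (intro mult_pos_pos prod_pos) auto
    have "poly V (x k) = (1 - x k) * x k * poly R (x k)"
      by (simp add: V_def numerator_step_def W0 W1 algebra_simps)
    then have "(-1) ^ i * poly V (z i) = ((1 - x k) * (- x k)) * ((-1) ^ k * poly R (x k))"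
      using Suc by (simp add: z_def)
    also have "\<dots> > 0"
      by (rule mult_pos_pos[OF _ R_pos], rule mult_pos_pos) (use x_neg[OF k] in auto)
    finally show ?thesis .
  qed
  have z_dec: "z (Suc i) < z i" if "i < e" for i
    using that x_neg x_dec by (cases i) (auto simp: z_def)
  have coeff_high: "coeff W k = 0" if "k > e" for k
    using degW that by (simp add: coeff_eq_0)
  have coeffV: "coeff V (Suc k) = coeff W k * (real d + 1 - real a - real k)
      + coeff W (Suc k) * (real (Suc k) + real a)" for k
    by (cases k) (simp_all add: V_def numerator_step_def coeff_linear_mult coeff_pderiv algebra_simps)
  have degV: "degree V \<le> Suc e"
  proof (rule degree_le, intro allI impI)
    fix k assume "Suc e < k"
    then obtain l where "k = Suc l" "l > e" by (cases k) auto
    then show "coeff V k = 0" by (simp add: coeffV coeff_high)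
  qed
  have topV: "coeff V (Suc e) = c * (real s + 1 - real a)"
  proof -
    have "real d = real e + real s" using \<open>s \<le> d\<close> by (simp add: e_def)
    then show ?thesis by (simp add: coeffV coeff_high lcW)
  qed
  show ?thesis
  proof (cases "a = s + 1")
    case True
    have "degree V \<le> e"
    proof (intro degree_le allI impI)
      fix k assume "e < k"
      then consider "k = Suc e" | "Suc e < k" by linarith
      then show "coeff V k = 0"
        using topV degV True by cases (auto intro: coeff_eq_0)
    qed
    then have "simple_neg_rooted e V"
      using z_dec sgn by (intro simple_neg_rootedI_sign_changes[of V e z]) (auto simp: z_def)
    then show ?thesis using True by (simp add: V_def e_def)
  next
    case False
    then have "a \<le> s" using assms by simp
    then have top: "coeff V (Suc e) > 0" using c by (simp add: topV)
    then have dV: "degree V = Suc e"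
      using degV le_degree[of V "Suc e"] by auto
    obtain t where t: "t < z e" "(-1) ^ Suc e * poly V t > 0"
      using poly_sign_at_bot[of V "z e"] top dV by auto
    define z' where "z' = z(Suc e := t)"
    have "simple_neg_rooted (Suc e) V"
      using z_dec sgn t dV
      by (intro simple_neg_rootedI_sign_changes[of V "Suc e" z'])
         (auto simp: z_def[of 0] z'_def less_Suc_eq le_Suc_eq)
    then show ?thesis using \<open>a \<le> s\<close> \<open>s \<le> d\<close> by (simp add: V_def e_def Suc_diff_le)
  qed
qed

lemma simple_neg_rooted_complex_root_real:
  assumes "simple_neg_rooted e W" and "poly (map_poly complex_of_real W) z = 0"
  shows "z \<in> \<real>"
proof -
  obtain c x where c: "c > 0" and W: "W = smult c (\<Prod>i<e. [:- x i, 1:])"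
    using assms(1) unfolding simple_neg_rooted_def by blast
  have "poly (map_poly complex_of_real (\<Prod>i<k. [:- x i, 1:])) z
      = (\<Prod>i<k. z - complex_of_real (x i))" for k
  proof (induction k)
    case (Suc k)
    have *: "map_poly complex_of_real ([:- x k, 1:] * q)
        = [:- of_real (x k), 1:] * map_poly complex_of_real q" for q
    proof (rule poly_eqI)
      fix n show "coeff (map_poly complex_of_real ([:- x k, 1:] * q)) n
          = coeff ([:- of_real (x k), 1:] * map_poly complex_of_real q) n"
        by (cases n) (simp_all add: coeff_map_poly)
    qed
    have "(\<Prod>i<Suc k. [:- x i, 1:]) = [:- x k, 1:] * (\<Prod>i<k. [:- x i, 1:])"
      by (simp only: prod.lessThan_Suc mult.commute)
    then show ?case
      by (simp only: * poly_mult Suc) (simp add: algebra_simps)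
  qed simp
  moreover have "map_poly complex_of_real W =
      smult (of_real c) (map_poly complex_of_real (\<Prod>i<e. [:- x i, 1:]))"
    unfolding W by (rule poly_eqI) (auto simp: coeff_map_poly)
  ultimately have "(\<Prod>i<e. z - complex_of_real (x i)) = 0"
    using assms(2) c by simp
  then show ?thesis by (auto simp: prod_zero_iff)
qed

section \<open>Power series and their numerators\<close>

lemma fps_numerator_step:
  assumes "fps_of_poly W = Abs_fps f * (1 - fps_X) ^ Suc d"
  shows "fps_of_poly (numerator_step d a W)
       = Abs_fps (\<lambda>k. (real k + real a) * f k) * (1 - fps_X) ^ Suc (Suc d)"
proof -
  define F where "F = Abs_fps f"
  have shift: "Abs_fps (\<lambda>k. (real k + real a) * f k) = fps_X * fps_deriv F + fps_const (real a) * F"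
    by (rule fps_ext) (simp add: F_def fps_mult_fps_X_deriv_shift algebra_simps)
  have lin: "fps_of_poly [:1, -1 :: real:] = 1 - fps_X"
    by (simp add: fps_of_poly_linear')
  have W: "fps_of_poly W = F * (1 - fps_X) ^ Suc d" using assms by (simp add: F_def)
  have dW: "fps_of_poly (pderiv W)
      = fps_deriv F * (1 - fps_X) ^ Suc d - fps_const (real d + 1) * (F * (1 - fps_X) ^ d)"
  proof -
    have "fps_deriv ((1 - fps_X :: real fps) ^ Suc d) = - (fps_const (real d + 1) * (1 - fps_X) ^ d)"
    proof -
      have "fps_deriv (1 - fps_X :: real fps) = - 1" by simp
      moreover have "real d + 1 = real (Suc d)" by simp
      ultimately show ?thesis
        by (simp only: fps_deriv_power diff_Suc_1 mult_minus_left mult_minus_right mult_1_right)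
    qed
    then show ?thesis
      unfolding fps_of_poly_pderiv W fps_deriv_mult by (simp only: mult_minus_left mult_minus_right mult_ac add_ac diff_conv_add_uminus)
  qed
  \<comment> \<open>The summand \<open>(d + 1) X W\<close> cancels what the derivative of
    \<open>(1 - X) ^ (d + 1)\<close> contributes.\<close>
  show ?thesis
    unfolding numerator_step_def fps_of_poly_add fps_of_poly_mult fps_of_poly_smult lin
      fps_of_poly_fps_X dW shift W
    by (simp add: algebra_simps)
qed

text \<open>In all uses \<open>f\<close> is a product of \<open>d\<close> factors \<open>k + a\<close>, the set of the occurring \<open>a\<close> being \<open>{1..s}\<close>.\<close>

definition real_rooted_series :: "nat \<Rightarrow> nat \<Rightarrow> (nat \<Rightarrow> real) \<Rightarrow> bool" where
  "real_rooted_series d s f \<longleftrightarrow> s \<le> d \<and>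
     (\<exists>W. simple_neg_rooted (d - s) W \<and> fps_of_poly W = Abs_fps f * (1 - fps_X) ^ Suc d)"

lemma real_rooted_series_step:
  assumes "real_rooted_series d s f" "1 \<le> a" "a \<le> s + 1"
  shows "real_rooted_series (Suc d) (max s a) (\<lambda>k. (real k + real a) * f k)"
proof -
  obtain W where "s \<le> d" "simple_neg_rooted (d - s) W"
    "fps_of_poly W = Abs_fps f * (1 - fps_X) ^ Suc d"
    using assms(1) unfolding real_rooted_series_def by blast
  then have "simple_neg_rooted (Suc d - max s a) (numerator_step d a W)"
    and "fps_of_poly (numerator_step d a W)
       = Abs_fps (\<lambda>k. (real k + real a) * f k) * (1 - fps_X) ^ Suc (Suc d)"
    using assms simple_neg_rooted_numerator_step fps_numerator_step by blast+
  then show ?thesis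
    using \<open>s \<le> d\<close> assms(3) unfolding real_rooted_series_def by auto
qed

lemma real_rooted_series_1: "real_rooted_series 0 0 (\<lambda>_. 1)"
proof -
  have "simple_neg_rooted 0 1"
    unfolding simple_neg_rooted_def by (intro exI[of _ 1]) auto
  moreover have "Abs_fps (\<lambda>_. 1 :: real) * (1 - fps_X) = 1"
    by (rule fps_ext) (auto simp: right_diff_distrib)
  ultimately show ?thesis
    unfolding real_rooted_series_def by (intro conjI exI[of _ 1]) auto
qed

text \<open>Inserting \<open>i + 1, ..., i + n\<close> in increasing order keeps each at most 1
  above the current maximum, as \<open>i \<le> s\<close>.\<close>

lemma real_rooted_series_row:
  assumes "real_rooted_series d s f" "i \<le> s"
  shows "real_rooted_series (d + n) (max s (i + n)) (\<lambda>k. f k * (\<Prod>j=1..n. real (k + i + j)))"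
proof (induction n)
  case 0
  then show ?case using assms by (simp add: max_absorb1)
next
  case (Suc n)
  have "real_rooted_series (Suc (d + n)) (max (max s (i + n)) (i + Suc n))
      (\<lambda>k. (real k + real (i + Suc n)) * (f k * (\<Prod>j=1..n. real (k + i + j))))"
    by (rule real_rooted_series_step[OF Suc]) auto
  then show ?case by (simp add: algebra_simps max.assoc)
qed

text \<open>The bound \<open>s \<ge> m\<close> is what allows row \<open>i = m\<close> to be
  appended; \<open>n > 0\<close> then raises it to \<open>m + 1\<close>.\<close>

lemma real_rooted_series_box:
  assumes "n > 0"
  shows "\<exists>s\<ge>m. real_rooted_series (m * n) s (\<lambda>k. \<Prod>i<m. \<Prod>j=1..n. real (k + i + j))"
proof (induction m)
  case 0
  then show ?case using real_rooted_series_1 by auto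
next
  case (Suc m)
  then obtain s where s: "s \<ge> m"
    "real_rooted_series (m * n) s (\<lambda>k. \<Prod>i<m. \<Prod>j=1..n. real (k + i + j))" by blast
  show ?case
    using real_rooted_series_row[OF s(2,1), of n] assms
    by (intro exI[of _ "max s (m + n)"]) (auto simp: algebra_simps)
qed

subsection \<open>Narayana polynomials\<close>

text \<open>Multiplying by \<open>1 - X\<close> takes differences of coefficients, which by Pascal's
  rule lowers \<open>p\<close>.\<close>

lemma fps_binomial_power:
  "Abs_fps (\<lambda>k. real ((k + p) choose p)) * (1 - fps_X) ^ Suc p = 1"
proof (induction p)
  case 0
  show ?case by (rule fps_ext) (auto simp: right_diff_distrib)
next
  case (Suc p)
  have "Abs_fps (\<lambda>k. real ((k + Suc p) choose Suc p)) * (1 - fps_X)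
      = Abs_fps (\<lambda>k. real ((k + p) choose p))"
  proof (rule fps_ext)
    fix k
    show "fps_nth (Abs_fps (\<lambda>k. real ((k + Suc p) choose Suc p)) * (1 - fps_X)) k
        = fps_nth (Abs_fps (\<lambda>k. real ((k + p) choose p))) k"
      by (cases k) (simp_all add: right_diff_distrib)
  qed
  then show ?case using Suc by (simp only: power_Suc2[of _ "Suc p"] power_Suc mult.assoc[symmetric])
qed

lemma fps_X_power_eq_binomial:
  assumes "d \<le> p"
  shows "fps_X ^ d = Abs_fps (\<lambda>k. real ((k + p - d) choose p)) * (1 - fps_X) ^ Suc p"
proof -
  \<comment> \<open>Since \<open>d \<le> p\<close> nothing is truncated, and for
    \<open>k < d\<close> the upper index is below \<open>p\<close>, giving the zeros of the shifted
    series.\<close>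
  have "Abs_fps (\<lambda>k. real ((k + p - d) choose p)) = fps_X ^ d * Abs_fps (\<lambda>k. real ((k + p) choose p))"
    using assms by (intro fps_ext) (auto simp: fps_X_power_mult_nth binomial_eq_0)
  then show ?thesis by (simp only: mult.assoc fps_binomial_power mult_1_right)
qed

lemma fps_narayana_poly:
  assumes "m > 0" "n > 0"
  shows "fps_of_poly (narayana_poly n m) =
    fps_const (\<Prod>i<m. fact i / fact (n + i)) *
    Abs_fps (\<lambda>k. \<Prod>i<m. \<Prod>j=1..n. real (k + i + j)) * (1 - fps_X) ^ Suc (m * n)"
proof -
  have d: "des w \<le> n * m" if "w \<in> lattice_words n m" for w
    using des_le[of w] that by (auto simp: lattice_words_def)
  have "fps_of_poly (narayana_poly n m) = (\<Sum>w\<in>lattice_words n m. fps_X ^ des w)"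
    by (simp add: narayana_poly_def fps_of_poly_sum fps_of_poly_monom')
  also have "\<dots> = (\<Sum>w\<in>lattice_words n m.
      Abs_fps (\<lambda>k. real ((k + n * m - des w) choose (n * m))) * (1 - fps_X) ^ Suc (n * m))"
    by (intro sum.cong refl fps_X_power_eq_binomial d)
  also have "\<dots> = (\<Sum>w\<in>lattice_words n m. Abs_fps (\<lambda>k. real ((k + n * m - des w) choose (n * m)))) *
      (1 - fps_X) ^ Suc (n * m)"
    by (simp only: sum_distrib_right)
  also have "(\<Sum>w\<in>lattice_words n m. Abs_fps (\<lambda>k. real ((k + n * m - des w) choose (n * m)))) =
      fps_const (\<Prod>i<m. fact i / fact (n + i)) *
      Abs_fps (\<lambda>k. \<Prod>i<m. \<Prod>j=1..n. real (k + i + j))"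
    by (rule fps_ext) (simp add: fps_sum_nth sum_binomial_lattice_words[OF assms])
  finally show ?thesis by (simp only: mult.commute[of n m])
qed

theorem theorem3p1:
  fixes m n :: nat and z :: complex
  assumes "m > 0" and "n > 0"
    and "poly (map_poly complex_of_real (narayana_poly n m)) z = 0"
  shows "z \<in> \<real>"
proof -
  define c :: real where "c = (\<Prod>i<m. fact i / fact (n + i))"
  have "c > 0" by (auto simp: c_def intro!: prod_pos)
  obtain s W where W: "simple_neg_rooted (m * n - s) W"
    "fps_of_poly W =
      Abs_fps (\<lambda>k. \<Prod>i<m. \<Prod>j=1..n. real (k + i + j)) * (1 - fps_X) ^ Suc (m * n)"
    using real_rooted_series_box[OF \<open>n > 0\<close>, of m] unfolding real_rooted_series_def by blast
  \<comment> \<open>Both numerators belong to proportional series over the same power of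
    \<open>1 - X\<close>, so they differ by the positive factor \<open>c\<close>.\<close>
  have "fps_of_poly (narayana_poly n m) = fps_of_poly (smult c W)"
    by (simp only: fps_narayana_poly[OF assms(1,2)] fps_of_poly_smult W(2) c_def mult.assoc)
  then have "narayana_poly n m = smult c W" by (simp only: fps_of_poly_eq_iff)
  moreover have "map_poly complex_of_real (smult c W) = smult (of_real c) (map_poly complex_of_real W)"
    by (rule poly_eqI) (simp add: coeff_map_poly)
  ultimately have "poly (map_poly complex_of_real W) z = 0"
    using assms(3) \<open>c > 0\<close> by simp
  with W(1) show ?thesis by (rule simple_neg_rooted_complex_root_real)
qed

end
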